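(* In the uncorrelated-signals setting of the context with $|V|=n$, assume common knowledge of beliefs (for all $u,w\in V$, $X_u$ is a.s.\ $\mathcal{F}_w$-measurable) and let $X$ be such that almost surely $X=X_u$ for all $u\in V$. Then $$\mathrm{Var}(X-S)\le\frac{D}{n+D},$$ where $D=D(\mu_1,\mu_0)$ is the noise to signal ratio.
   Context: The state $S$ is uniform on $\{0,1\}$. $\mu_0\neq\mu_1$ are mutually absolutely continuous probability measures on $(\Omega,\mathcal{O})$, and $z(\omega)=\log\frac{d\mu_1}{d\mu_0}(\omega)$; assume $z$ has finite second moment under both $\mu_0$ and $\mu_1$. Uncorrelated-signals setting: $V$ is a set of $n$ agents, agent $u$ has private signal $W_u\in\Omega$; conditionally on $S$, each $W_u$ has law $\mu_S$ (the joint law may be dependent), and with $z_u=z(W_u)$ one has $\mathrm{Cov}(z_u,z_v\mid S)=0$ for all distinct $u,v\in V$. Each agent's information is a $\sigma$-algebra $\mathcal{F}_u$ with $\sigma(W_u)\subseteq\mathcal{F}_u\subseteq\sigma(W_v:v\in V)$, and $X_u=\mathbb{P}(S=1\mid\mathcal{F}_u)$. The noise to signal ratio is $$D(\mu_1,\mu_0)=2\,\frac{\mathrm{Var}_{\mu_1}(z)+\mathrm{Var}_{\mu_0}(z)}{\big(D_{KL}(\mu_1\|\mu_0)+D_{KL}(\mu_0\|\mu_1)\big)^2}.$$ *)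

theory Defs
  imports "HOL-Probability.Probability"
begin

text \<open>Log-likelihood ratio z = log (d mu1 / d mu0) (natural logarithm).\<close>
definition llr :: "'b measure \<Rightarrow> 'b measure \<Rightarrow> 'b \<Rightarrow> real" where
  "llr mu0 mu1 w = ln (enn2real (RN_deriv mu0 mu1 w))"

definition var_under :: "'b measure \<Rightarrow> ('b \<Rightarrow> real) \<Rightarrow> real" where
  "var_under P f = (\<integral>x. (f x - (\<integral>y. f y \<partial>P))\<^sup>2 \<partial>P)"

definition noise_signal_ratio :: "'b measure \<Rightarrow> 'b measure \<Rightarrow> real" where
  "noise_signal_ratio mu1 mu0 =
     2 * (var_under mu1 (llr mu0 mu1) + var_under mu0 (llr mu0 mu1)) /
     (KL_divergence (exp 1) mu0 mu1 + KL_divergence (exp 1) mu1 mu0)\<^sup>2"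

definition cond_ev :: "'a measure \<Rightarrow> 'a set \<Rightarrow> ('a \<Rightarrow> real) \<Rightarrow> real" where
  "cond_ev M A f = (\<integral>x. f x * indicator A x \<partial>M) / measure M A"

definition cond_cov :: "'a measure \<Rightarrow> 'a set \<Rightarrow> ('a \<Rightarrow> real) \<Rightarrow> ('a \<Rightarrow> real) \<Rightarrow> real" where
  "cond_cov M A f g = cond_ev M A (\<lambda>x. f x * g x) - cond_ev M A f * cond_ev M A g"

end

theory Submission
  imports Defs
begin

text \<open>Each log-likelihood ratio \<open>z_u\<close> is measurable for agent \<open>u\<close>'s information and the
  common estimate \<open>X\<close> is the conditional expectation of the state given every \<open>F_u\<close>, so the
  residual \<open>S - X\<close> is orthogonal to \<open>1\<close>, to \<open>X\<close> and to every \<open>z_u\<close>. Hence \<open>X\<close> has smaller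
  mean-square error than any affine predictor \<open>a + c \<Sum>u z_u\<close>. Given the state, the \<open>z_u\<close> are
  uncorrelated with a common mean and variance, and the two means differ by the symmetrised
  Kullback-Leibler divergence; optimising \<open>a\<close> and \<open>c\<close> gives the error \<open>D / (4 (n + D))\<close>,
  a factor 4 better than the bound claimed.\<close>

section \<open>The log-likelihood ratio\<close>

lemma AE_RN_deriv_reciprocal:
  assumes "sigma_finite_measure mu0" "sigma_finite_measure mu1"
    and sets_eq: "sets mu1 = sets mu0"
    and ac01: "absolutely_continuous mu0 mu1" and ac10: "absolutely_continuous mu1 mu0"
  shows "AE x in mu0. 0 < enn2real (RN_deriv mu0 mu1 x) \<and>
     enn2real (RN_deriv mu1 mu0 x) = 1 / enn2real (RN_deriv mu0 mu1 x)"
proof -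
  interpret P0: sigma_finite_measure mu0 by fact
  interpret P1: sigma_finite_measure mu1 by fact
  define r where "r = RN_deriv mu0 mu1"
  define D where "D x = enn2real (r x)" for x
  have dens: "density mu0 r = mu1"
    unfolding r_def using P0.density_RN_deriv[OF ac01 sets_eq] .
  have "emeasure mu1 {x\<in>space mu0. r x = 0} = (\<integral>\<^sup>+x. r x * indicator {x\<in>space mu0. r x = 0} x \<partial>mu0)"
    unfolding dens[symmetric] by (subst emeasure_density) (auto simp: r_def)
  also have "\<dots> = 0"
    by (auto intro!: nn_integral_zero' split: split_indicator)
  finally have "AE x in mu1. r x \<noteq> 0"
    using sets_eq_imp_space_eq[OF sets_eq] sets_eq
    by (intro AE_I[where N="{x\<in>space mu0. r x = 0}"]) (auto simp: r_def)
  then have nonzero: "AE x in mu0. r x \<noteq> 0"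
    using absolutely_continuous_AE[OF sets_eq[symmetric] ac10] by blast
  have finite: "AE x in mu0. r x \<noteq> \<infinity>"
    unfolding r_def using P0.RN_deriv_finite[OF P1.sigma_finite_measure_axioms ac01 sets_eq] .
  have rD: "AE x in mu0. r x = ennreal (D x) \<and> 0 < D x"
    using finite nonzero
    by eventually_elim (auto simp: D_def enn2real_positive_iff less_top zero_less_iff_neq_zero)
  have "density mu1 (\<lambda>x. ennreal (1 / D x)) = density mu0 (\<lambda>x. r x * ennreal (1 / D x))"
    unfolding dens[symmetric] by (rule density_density_eq) (auto simp: r_def D_def)
  also have "\<dots> = density mu0 (\<lambda>_. 1)"
  proof (rule density_cong)
    show "AE x in mu0. r x * ennreal (1 / D x) = 1"
      using rD by eventually_elim (simp add: ennreal_mult[symmetric])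
  qed (auto simp: r_def D_def)
  finally have "AE x in mu1. ennreal (1 / D x) = RN_deriv mu1 mu0 x"
    using sets_eq by (intro P1.RN_deriv_unique) (auto simp: density_1 D_def r_def)
  then have "AE x in mu0. ennreal (1 / D x) = RN_deriv mu1 mu0 x"
    using absolutely_continuous_AE[OF sets_eq[symmetric] ac10] by blast
  with rD show ?thesis
    by eventually_elim (auto simp: D_def r_def dest: sym)
qed

lemma (in information_space) KL_nonneg_ac:
  assumes "prob_space N"
    and ac: "absolutely_continuous M N" "sets N = sets M"
    and int: "integrable N (entropy_density b M N)"
  shows "0 \<le> KL_divergence b M N"
proof -
  interpret N: prob_space N by fact
  have "finite_measure N" by unfold_locales
  from real_RN_deriv[OF this ac] obtain D where D:
      "random_variable borel D" "AE x in M. RN_deriv M N x = ennreal (D x)"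
      "AE x in N. 0 < D x" "\<And>x. 0 \<le> D x"
    by this auto
  have "N = density M (RN_deriv M N)"
    using ac by (rule density_RN_deriv[symmetric])
  also have "\<dots> = density M D"
    using D by (auto intro!: density_cong)
  finally have N: "N = density M D" .
  from absolutely_continuous_AE[OF ac(2,1) D(2)] D b_gt_1 ac measurable_entropy_density
  have "integrable N (\<lambda>x. log b (D x))"
    by (intro integrable_cong_AE[THEN iffD2, OF _ _ _ int])
       (auto simp: N entropy_density_def)
  with D b_gt_1 have "integrable M (\<lambda>x. D x * log b (D x))"
    by (subst integrable_real_density[symmetric]) (auto simp: N[symmetric] comp_def)
  with \<open>prob_space N\<close> D show ?thesis
    unfolding N by (intro KL_nonneg) auto
qed

lemma llr_measurable[measurable]: "llr mu0 mu1 \<in> borel_measurable mu0"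
  unfolding llr_def by simp

lemma llr_measurable_cong: "sets mu = sets mu0 \<Longrightarrow> llr mu0 mu1 \<in> borel_measurable mu"
  using llr_measurable measurable_cong_sets[of mu mu0] by blast

lemma entropy_density_eq_llr: "entropy_density (exp 1) mu0 mu1 = llr mu0 mu1"
  by (simp add: fun_eq_iff entropy_density_def llr_def log_def)

lemma KL_divergence_eq_integral_llr:
  "KL_divergence (exp 1) mu0 mu1 = (\<integral>w. llr mu0 mu1 w \<partial>mu1)"
  unfolding KL_divergence_def entropy_density_eq_llr ..

lemma AE_entropy_density_swap:
  assumes "sigma_finite_measure mu0" "sigma_finite_measure mu1" "sets mu1 = sets mu0"
    and "absolutely_continuous mu0 mu1" "absolutely_continuous mu1 mu0"
  shows "AE x in mu0. entropy_density (exp 1) mu1 mu0 x = - llr mu0 mu1 x"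
  using AE_RN_deriv_reciprocal[OF assms]
  by eventually_elim (simp add: entropy_density_def llr_def log_def ln_div)

lemma KL_divergence_swap_eq_integral_llr:
  assumes "sigma_finite_measure mu0" "sigma_finite_measure mu1" and sets_eq: "sets mu1 = sets mu0"
    and "absolutely_continuous mu0 mu1" "absolutely_continuous mu1 mu0"
  shows "KL_divergence (exp 1) mu1 mu0 = - (\<integral>w. llr mu0 mu1 w \<partial>mu0)"
proof -
  have "entropy_density (exp 1) mu1 mu0 \<in> borel_measurable mu0"
    by (subst measurable_cong_sets[OF sets_eq[symmetric] refl]) simp
  then show ?thesis
    unfolding KL_divergence_def
    using integral_cong_AE[OF _ _ AE_entropy_density_swap[OF assms]] by simp
qed

text \<open>The gap is the symmetrised Kullback-Leibler divergence, positive since \<open>mu0 \<noteq> mu1\<close>.\<close>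
lemma integral_llr_less:
  assumes mu0: "prob_space mu0" and mu1: "prob_space mu1" and sets_eq: "sets mu1 = sets mu0"
    and neq: "mu0 \<noteq> mu1"
    and ac01: "absolutely_continuous mu0 mu1" and ac10: "absolutely_continuous mu1 mu0"
    and int0: "integrable mu0 (llr mu0 mu1)" and int1: "integrable mu1 (llr mu0 mu1)"
  shows "(\<integral>w. llr mu0 mu1 w \<partial>mu0) < (\<integral>w. llr mu0 mu1 w \<partial>mu1)"
proof -
  interpret P0: information_space mu0 "exp 1"
    using mu0 by (simp add: information_space_def information_space_axioms_def)
  interpret P1: information_space mu1 "exp 1"
    using mu1 by (simp add: information_space_def information_space_axioms_def)
  have sf: "sigma_finite_measure mu0" "sigma_finite_measure mu1" by unfold_locales
  have "entropy_density (exp 1) mu1 mu0 \<in> borel_measurable mu0"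
    by (subst measurable_cong_sets[OF sets_eq[symmetric] refl]) simp
  then have "integrable mu0 (entropy_density (exp 1) mu1 mu0)"
    by (subst integrable_cong_AE[OF _ _ AE_entropy_density_swap[OF sf sets_eq ac01 ac10]]) (auto simp: int0)
  then have "0 \<le> KL_divergence (exp 1) mu1 mu0"
    by (rule P1.KL_nonneg_ac[OF mu0 ac10 sets_eq[symmetric]])
  moreover have "KL_divergence (exp 1) mu0 mu1 \<noteq> 0"
    using P0.KL_eq_0_iff_eq_ac[OF mu1 ac01 sets_eq] int1 neq by (auto simp: entropy_density_eq_llr)
  moreover have "0 \<le> KL_divergence (exp 1) mu0 mu1"
    using P0.KL_nonneg_ac[OF mu1 ac01 sets_eq] int1 by (simp add: entropy_density_eq_llr)
  ultimately show ?thesis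
    using KL_divergence_eq_integral_llr[of mu0 mu1] KL_divergence_swap_eq_integral_llr[OF sf sets_eq ac01 ac10]
    by linarith
qed

lemma noise_signal_ratio_eq:
  assumes "sigma_finite_measure mu0" "sigma_finite_measure mu1" "sets mu1 = sets mu0"
    and "absolutely_continuous mu0 mu1" "absolutely_continuous mu1 mu0"
  shows "noise_signal_ratio mu1 mu0 =
    2 * (var_under mu1 (llr mu0 mu1) + var_under mu0 (llr mu0 mu1)) /
    ((\<integral>w. llr mu0 mu1 w \<partial>mu1) - (\<integral>w. llr mu0 mu1 w \<partial>mu0))\<^sup>2"
  by (simp add: noise_signal_ratio_def KL_divergence_swap_eq_integral_llr[OF assms]
      KL_divergence_eq_integral_llr[of mu0 mu1])

lemma var_under_nonneg: "0 \<le> var_under P f"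
  unfolding var_under_def by simp

lemma var_under_eq:
  assumes "prob_space P" "f \<in> borel_measurable P" "integrable P (\<lambda>x. (f x)\<^sup>2)"
  shows "var_under P f = (\<integral>x. (f x)\<^sup>2 \<partial>P) - (\<integral>x. f x \<partial>P)\<^sup>2"
proof -
  interpret prob_space P by fact
  have "integrable P f" using assms(2,3) by (rule square_integrable_imp_integrable)
  then show ?thesis unfolding var_under_def using variance_eq[of f] assms(3) by simp
qed

lemma integrable_mult_square_integrable:
  fixes f g :: "'a \<Rightarrow> real"
  assumes [measurable]: "f \<in> borel_measurable M" "g \<in> borel_measurable M"
    and "integrable M (\<lambda>x. (f x)\<^sup>2)" "integrable M (\<lambda>x. (g x)\<^sup>2)"
  shows "integrable M (\<lambda>x. f x * g x)"
proof (rule Bochner_Integration.integrable_bound)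
  show "integrable M (\<lambda>x. (f x)\<^sup>2 + (g x)\<^sup>2)"
    using assms(3,4) by simp
  have "\<bar>f x * g x\<bar> \<le> (f x)\<^sup>2 + (g x)\<^sup>2" for x
    using sum_squares_bound[of "\<bar>f x\<bar>" "\<bar>g x\<bar>"] abs_ge_zero[of "f x * g x"]
    unfolding abs_mult power2_abs by linarith
  then show "AE x in M. norm (f x * g x) \<le> norm ((f x)\<^sup>2 + (g x)\<^sup>2)"
    by simp
qed simp

section \<open>Moments of signals on an event\<close>

lemma integral_comp_indicator:
  fixes f :: "'b \<Rightarrow> real"
  assumes "finite_measure M" "finite_measure mu"
    and W[measurable]: "W \<in> measurable M mu" and A[measurable]: "A \<in> sets M"
    and law: "\<forall>B\<in>sets mu. measure M {x\<in>space M. x \<in> A \<and> W x \<in> B} = measure M A * measure mu B"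
    and f: "integrable mu f"
  shows "integrable M (\<lambda>x. f (W x) * indicator A x)"
    "(\<integral>x. f (W x) * indicator A x \<partial>M) = measure M A * (\<integral>w. f w \<partial>mu)"
proof -
  interpret M: finite_measure M by fact
  interpret mu: finite_measure mu by fact
  have [measurable]: "f \<in> borel_measurable mu" using f by blast
  define MA where "MA = density M (\<lambda>x. ennreal (indicator A x))"
  have W_MA[measurable]: "W \<in> measurable MA mu" by (simp add: MA_def)
  have law_MA: "distr MA mu W = density mu (\<lambda>_. ennreal (measure M A))"
  proof (rule measure_eqI)
    fix B assume "B \<in> sets (distr MA mu W)"
    then have B[measurable]: "B \<in> sets mu" by simp
    have "emeasure (distr MA mu W) B = emeasure MA (W -` B \<inter> space M)"
      using emeasure_distr[OF W_MA B] by (simp only: MA_def space_density)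
    also have "\<dots> = (\<integral>\<^sup>+x. indicator {x\<in>space M. x \<in> A \<and> W x \<in> B} x \<partial>M)"
      unfolding MA_def
      by (subst emeasure_density; (intro nn_integral_cong)?) (auto split: split_indicator)
    also have "\<dots> = emeasure M {x\<in>space M. x \<in> A \<and> W x \<in> B}"
      by simp
    also have "\<dots> = emeasure (density mu (\<lambda>_. ennreal (measure M A))) B"
      using law B by (simp add: M.emeasure_eq_measure mu.emeasure_eq_measure emeasure_density
          nn_integral_cmult_indicator ennreal_mult)
    finally show "emeasure (distr MA mu W) B = emeasure (density mu (\<lambda>_. ennreal (measure M A))) B" .
  qed simp
  have "integrable (distr MA mu W) f"
    unfolding law_MA using f by (subst integrable_density) auto
  then show "integrable M (\<lambda>x. f (W x) * indicator A x)"
    by (simp add: integrable_distr_eq MA_def integrable_density mult.commute)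
  have "(\<integral>w. f w \<partial>distr MA mu W) = measure M A * (\<integral>w. f w \<partial>mu)"
    unfolding law_MA by (subst integral_density) auto
  then show "(\<integral>x. f (W x) * indicator A x \<partial>M) = measure M A * (\<integral>w. f w \<partial>mu)"
    by (simp add: integral_distr MA_def integral_density mult.commute)
qed

lemma integral_mult_comp_indicator:
  fixes f :: "'b \<Rightarrow> real" and W :: "'v \<Rightarrow> 'a \<Rightarrow> 'b"
  assumes "prob_space M" "prob_space mu"
    and A[measurable]: "A \<in> sets M" and pA: "0 < measure M A"
    and W: "\<forall>u\<in>V. W u \<in> measurable M mu"
    and law: "\<forall>u\<in>V. \<forall>B\<in>sets mu.
      measure M {x\<in>space M. x \<in> A \<and> W u x \<in> B} = measure M A * measure mu B"
    and f[measurable]: "f \<in> borel_measurable mu" and f_sq: "integrable mu (\<lambda>w. (f w)\<^sup>2)"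
    and uncorr: "\<forall>u\<in>V. \<forall>v\<in>V. u \<noteq> v \<longrightarrow> cond_cov M A (\<lambda>x. f (W u x)) (\<lambda>x. f (W v x)) = 0"
    and u: "u \<in> V" and v: "v \<in> V"
  shows "integrable M (\<lambda>x. f (W u x) * f (W v x) * indicator A x)"
    "(\<integral>x. f (W u x) * f (W v x) * indicator A x \<partial>M) =
      measure M A * (if u = v then \<integral>w. (f w)\<^sup>2 \<partial>mu else (\<integral>w. f w \<partial>mu)\<^sup>2)"
proof -
  interpret M: prob_space M by fact
  interpret mu: prob_space mu by fact
  have f_int: "integrable mu f"
    using f f_sq by (rule mu.square_integrable_imp_integrable)
  note transfer = integral_comp_indicator[OF M.finite_measure_axioms mu.finite_measure_axioms _ A]
  have mean: "cond_ev M A (\<lambda>x. f (W u' x)) = (\<integral>w. f w \<partial>mu)" if "u' \<in> V" for u'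
    using transfer[OF _ _ f_int] W law that pA by (simp add: cond_ev_def)
  have sq: "integrable M (\<lambda>x. (f (W u' x))\<^sup>2 * indicator A x)"
    "(\<integral>x. (f (W u' x))\<^sup>2 * indicator A x \<partial>M) = measure M A * (\<integral>w. (f w)\<^sup>2 \<partial>mu)"
    if "u' \<in> V" for u'
    using transfer[OF _ _ f_sq] W law that by auto
  have sq_indicator: "(f (W u' x) * indicator A x)\<^sup>2 = (f (W u' x))\<^sup>2 * indicator A x" for u' x
    by (simp split: split_indicator)
  have "integrable M (\<lambda>x. (f (W u x) * indicator A x) * (f (W v x) * indicator A x))"
    using W u v sq[OF u] sq[OF v]
    by (intro integrable_mult_square_integrable) (auto simp: sq_indicator)
  moreover have "(f (W u x) * indicator A x) * (f (W v x) * indicator A x)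
      = f (W u x) * f (W v x) * indicator A x" for x
    by (simp split: split_indicator)
  ultimately show "integrable M (\<lambda>x. f (W u x) * f (W v x) * indicator A x)"
    by simp
  show "(\<integral>x. f (W u x) * f (W v x) * indicator A x \<partial>M) =
      measure M A * (if u = v then \<integral>w. (f w)\<^sup>2 \<partial>mu else (\<integral>w. f w \<partial>mu)\<^sup>2)"
  proof (cases "u = v")
    case True
    then show ?thesis using sq(2)[OF u] by (simp add: power2_eq_square)
  next
    case False
    then have "cond_ev M A (\<lambda>x. f (W u x) * f (W v x)) = (\<integral>w. f w \<partial>mu)\<^sup>2"
      using uncorr u v mean[OF u] mean[OF v] by (simp add: cond_cov_def power2_eq_square)
    with False pA show ?thesis
      by (simp add: cond_ev_def field_simps)
  qed
qed

lemma sum_if_eq_diagonal: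
  fixes q r :: real
  assumes "finite V" "u \<in> V"
  shows "(\<Sum>v\<in>V. if u = v then q else r) = card V * r + (q - r)"
proof -
  have "(\<Sum>v\<in>V. if u = v then q else r) = (\<Sum>v\<in>V. r + (if u = v then q - r else 0))"
    by (intro sum.cong) auto
  then show ?thesis
    using assms by (simp add: sum.distrib)
qed

lemma integral_sq_affine_sum_indicator:
  fixes Z :: "'v \<Rightarrow> 'a \<Rightarrow> real"
  assumes "finite_measure M" and V: "finite V" and A[measurable]: "A \<in> sets M"
    and first: "\<And>u. u \<in> V \<Longrightarrow> integrable M (\<lambda>x. Z u x * indicator A x) \<and>
      (\<integral>x. Z u x * indicator A x \<partial>M) = measure M A * m"
    and second: "\<And>u v. u \<in> V \<Longrightarrow> v \<in> V \<Longrightarrow> integrable M (\<lambda>x. Z u x * Z v x * indicator A x) \<and>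
      (\<integral>x. Z u x * Z v x * indicator A x \<partial>M) = measure M A * (if u = v then q else m\<^sup>2)"
  shows "integrable M (\<lambda>x. (t - c * (\<Sum>u\<in>V. Z u x))\<^sup>2 * indicator A x)"
    "(\<integral>x. (t - c * (\<Sum>u\<in>V. Z u x))\<^sup>2 * indicator A x \<partial>M) =
      measure M A * ((t - c * card V * m)\<^sup>2 + c\<^sup>2 * card V * (q - m\<^sup>2))"
proof -
  interpret finite_measure M by fact
  let ?n = "real (card V)"
  have expand: "(t - c * (\<Sum>u\<in>V. Z u x))\<^sup>2 * indicator A x =
      t\<^sup>2 * indicator A x - 2 * t * c * (\<Sum>u\<in>V. Z u x * indicator A x)
      + c\<^sup>2 * (\<Sum>u\<in>V. \<Sum>v\<in>V. Z u x * Z v x * indicator A x)" for x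
    by (simp add: power2_eq_square algebra_simps sum_product sum_distrib_left)
  have int_A: "integrable M (\<lambda>x. indicator A x :: real)"
    by (simp add: emeasure_eq_measure)
  have int_first: "integrable M (\<lambda>x. \<Sum>u\<in>V. Z u x * indicator A x)"
    and int_second: "integrable M (\<lambda>x. \<Sum>u\<in>V. \<Sum>v\<in>V. Z u x * Z v x * indicator A x)"
    using first second by auto
  then show "integrable M (\<lambda>x. (t - c * (\<Sum>u\<in>V. Z u x))\<^sup>2 * indicator A x)"
    unfolding expand using int_A by simp
  have mean: "(\<integral>x. (\<Sum>u\<in>V. Z u x * indicator A x) \<partial>M) = ?n * (measure M A * m)"
    using first by (simp add: integral_sum)
  have second_moment: "(\<integral>x. (\<Sum>u\<in>V. \<Sum>v\<in>V. Z u x * Z v x * indicator A x) \<partial>M)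
      = measure M A * (?n * (?n * m\<^sup>2 + (q - m\<^sup>2)))"
    using second sum_if_eq_diagonal[OF V] by (simp add: integral_sum sum_distrib_left[symmetric])
  have "(\<integral>x. (t - c * (\<Sum>u\<in>V. Z u x))\<^sup>2 * indicator A x \<partial>M) =
      t\<^sup>2 * measure M A - 2 * t * c * (\<integral>x. (\<Sum>u\<in>V. Z u x * indicator A x) \<partial>M)
      + c\<^sup>2 * (\<integral>x. (\<Sum>u\<in>V. \<Sum>v\<in>V. Z u x * Z v x * indicator A x) \<partial>M)"
    unfolding expand using int_A int_first int_second by simp
  also have "\<dots> = measure M A * ((t - c * card V * m)\<^sup>2 + c\<^sup>2 * card V * (q - m\<^sup>2))"
    unfolding mean second_moment by (simp add: power2_eq_square algebra_simps)
  finally show "(\<integral>x. (t - c * (\<Sum>u\<in>V. Z u x))\<^sup>2 * indicator A x \<partial>M) =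
      measure M A * ((t - c * card V * m)\<^sup>2 + c\<^sup>2 * card V * (q - m\<^sup>2))" .
qed

section \<open>Conditional expectation as an orthogonal projection\<close>

lemma measurable_vimage_algebra_subset:
  assumes "W \<in> measurable M N" "subalgebra M F"
    and "sets (vimage_algebra (space M) W N) \<subseteq> sets F"
  shows "W \<in> measurable F N"
proof -
  have "W \<in> measurable (vimage_algebra (space M) W N) N"
    using assms(1) by (intro measurable_vimage_algebra1) (simp add: measurable_def)
  then show ?thesis
    using assms(2,3) by (auto dest: measurable_mono[OF order_refl refl, of _ F] simp: subalgebra_def)
qed

lemma integrable_mult_bounded:
  fixes f g :: "'a \<Rightarrow> real"
  assumes "integrable M f" "g \<in> borel_measurable M" "\<And>x. \<bar>g x\<bar> \<le> 1"
  shows "integrable M (\<lambda>x. f x * g x)"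
proof (rule Bochner_Integration.integrable_bound[OF assms(1)])
  show "(\<lambda>x. f x * g x) \<in> borel_measurable M"
    using assms(1,2) by measurable
  show "AE x in M. norm (f x * g x) \<le> norm (f x)"
    using assms(3) by (auto simp: abs_mult intro!: mult_left_le)
qed

lemma (in sigma_finite_subalgebra) cond_exp_residual_orthogonal:
  fixes Y X h :: "'a \<Rightarrow> real"
  assumes [measurable]: "Y \<in> borel_measurable M" "h \<in> borel_measurable F" "X \<in> borel_measurable M"
    and hY: "integrable M (\<lambda>x. h x * Y x)"
    and X: "AE x in M. X x = real_cond_exp M F Y x"
  shows "integrable M (\<lambda>x. (Y x - X x) * h x)" "(\<integral>x. (Y x - X x) * h x \<partial>M) = 0"
proof -
  have [measurable]: "h \<in> borel_measurable M"
    by (rule measurable_from_subalg[OF subalg]) simp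
  have hX: "AE x in M. h x * X x = h x * real_cond_exp M F Y x"
    using X by eventually_elim simp
  have "integrable M (\<lambda>x. h x * X x)" "(\<integral>x. h x * X x \<partial>M) = (\<integral>x. h x * Y x \<partial>M)"
    using real_cond_exp_intg[OF hY] integrable_cong_AE[OF _ _ hX] integral_cong_AE[OF _ _ hX] by simp_all
  then show "integrable M (\<lambda>x. (Y x - X x) * h x)" "(\<integral>x. (Y x - X x) * h x \<partial>M) = 0"
    using hY by (simp_all add: algebra_simps)
qed

lemma (in sigma_finite_subalgebra) cond_exp_residual_orthogonal_self:
  fixes Y X :: "'a \<Rightarrow> real"
  assumes [measurable]: "Y \<in> borel_measurable M" "X \<in> borel_measurable M"
    and int: "integrable M (\<lambda>x. real_cond_exp M F Y x * Y x)"
    and X: "AE x in M. X x = real_cond_exp M F Y x"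
  shows "integrable M (\<lambda>x. (Y x - X x) * X x)" "(\<integral>x. (Y x - X x) * X x \<partial>M) = 0"
proof -
  have AE_eq: "AE x in M. (Y x - X x) * real_cond_exp M F Y x = (Y x - X x) * X x"
    using X by eventually_elim simp
  note orth = cond_exp_residual_orthogonal[OF _ borel_measurable_cond_exp _ int X]
  show "integrable M (\<lambda>x. (Y x - X x) * X x)" "(\<integral>x. (Y x - X x) * X x \<partial>M) = 0"
    using orth integrable_cong_AE[OF _ _ AE_eq] integral_cong_AE[OF _ _ AE_eq] by simp_all
qed

lemma integral_sq_le_of_orthogonal:
  fixes Y X g :: "'a \<Rightarrow> real"
  assumes "integrable M (\<lambda>x. (Y x - X x)\<^sup>2)" "integrable M (\<lambda>x. (Y x - g x)\<^sup>2)"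
    and "integrable M (\<lambda>x. (Y x - X x) * (X x - g x))" "(\<integral>x. (Y x - X x) * (X x - g x) \<partial>M) = 0"
  shows "(\<integral>x. (Y x - X x)\<^sup>2 \<partial>M) \<le> (\<integral>x. (Y x - g x)\<^sup>2 \<partial>M)"
proof -
  have "(\<integral>x. (Y x - X x)\<^sup>2 \<partial>M) = (\<integral>x. (Y x - X x)\<^sup>2 + 2 * ((Y x - X x) * (X x - g x)) \<partial>M)"
    using assms by simp
  also have "\<dots> \<le> (\<integral>x. (Y x - g x)\<^sup>2 \<partial>M)"
  proof (rule integral_mono)
    show "(Y x - X x)\<^sup>2 + 2 * ((Y x - X x) * (X x - g x)) \<le> (Y x - g x)\<^sup>2" for x
      using zero_le_power2[of "X x - g x"] by (simp add: power2_eq_square algebra_simps)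
  qed (use assms in auto)
  finally show ?thesis .
qed

lemma cond_exp_residual_orthogonal_affine_sum:
  fixes Y X :: "'a \<Rightarrow> real" and h :: "'v \<Rightarrow> 'a \<Rightarrow> real"
  assumes "prob_space M" and V: "finite V" "V \<noteq> {}"
    and F: "\<forall>u\<in>V. subalgebra M (F u)"
    and Y[measurable]: "Y \<in> borel_measurable M" and Y_bound: "\<And>x. \<bar>Y x\<bar> \<le> 1"
    and X[measurable]: "X \<in> borel_measurable M"
    and X_eq: "AE x in M. \<forall>u\<in>V. X x = real_cond_exp M (F u) Y x"
    and h: "\<forall>u\<in>V. h u \<in> borel_measurable (F u) \<and> integrable M (h u)"
  shows "integrable M (\<lambda>x. Y x - X x)" "(\<integral>x. Y x - X x \<partial>M) = 0"
    "integrable M (\<lambda>x. (Y x - X x)\<^sup>2)"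
    "integrable M (\<lambda>x. (Y x - X x) * (X x - (a + c * (\<Sum>u\<in>V. h u x))))"
    "(\<integral>x. (Y x - X x) * (X x - (a + c * (\<Sum>u\<in>V. h u x))) \<partial>M) = 0"
proof -
  interpret prob_space M by fact
  obtain u0 where u0: "u0 \<in> V" using V by blast
  interpret F0: finite_measure_subalgebra M "F u0"
    using F u0 by unfold_locales blast
  have X_eq_u: "AE x in M. X x = real_cond_exp M (F u) Y x" if "u \<in> V" for u
    using X_eq by (rule eventually_mono) (use that in blast)
  have Y_int: "integrable M Y"
    using Y_bound by (intro integrable_const_bound[where B=1]) auto
  have orth_h: "integrable M (\<lambda>x. (Y x - X x) * h u x) \<and> (\<integral>x. (Y x - X x) * h u x \<partial>M) = 0"
    if u: "u \<in> V" for u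
  proof -
    interpret Fu: finite_measure_subalgebra M "F u"
      using F u by unfold_locales blast
    have "integrable M (\<lambda>x. h u x * Y x)"
      using h u Y_bound by (intro integrable_mult_bounded) auto
    then show ?thesis
      using Fu.cond_exp_residual_orthogonal[OF Y _ X _ X_eq_u[OF u]] h u by blast
  qed
  show orth_1: "integrable M (\<lambda>x. Y x - X x)" "(\<integral>x. Y x - X x \<partial>M) = 0"
    using F0.cond_exp_residual_orthogonal[OF Y _ X _ X_eq_u[OF u0], of "\<lambda>_. 1"] Y_int by simp_all
  have "integrable M (\<lambda>x. real_cond_exp M (F u0) Y x * Y x)"
    using F0.real_cond_exp_int(1)[OF Y_int] Y Y_bound by (rule integrable_mult_bounded)
  note orth_X = F0.cond_exp_residual_orthogonal_self[OF Y X this X_eq_u[OF u0]]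
  have "integrable M (\<lambda>x. (Y x - X x) * Y x - (Y x - X x) * X x)"
    using integrable_mult_bounded[OF orth_1(1) Y Y_bound] orth_X(1) by simp
  then show "integrable M (\<lambda>x. (Y x - X x)\<^sup>2)"
    by (simp add: power2_eq_square right_diff_distrib)
  have expand: "(Y x - X x) * (X x - (a + c * (\<Sum>u\<in>V. h u x))) =
      (Y x - X x) * X x - a * (Y x - X x) - c * (\<Sum>u\<in>V. (Y x - X x) * h u x)" for x
    by (simp add: algebra_simps sum_distrib_left)
  show "integrable M (\<lambda>x. (Y x - X x) * (X x - (a + c * (\<Sum>u\<in>V. h u x))))"
    "(\<integral>x. (Y x - X x) * (X x - (a + c * (\<Sum>u\<in>V. h u x))) \<partial>M) = 0"
    unfolding expand using orth_h orth_1 orth_X by (simp_all add: integral_sum)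
qed

lemma cond_exp_mse_le_affine_sum:
  fixes Y X :: "'a \<Rightarrow> real" and h :: "'v \<Rightarrow> 'a \<Rightarrow> real"
  assumes M: "prob_space M" and V: "finite V" "V \<noteq> {}"
    and F: "\<forall>u\<in>V. subalgebra M (F u)"
    and Y: "Y \<in> borel_measurable M" "\<And>x. \<bar>Y x\<bar> \<le> 1"
    and X: "X \<in> borel_measurable M" "AE x in M. \<forall>u\<in>V. X x = real_cond_exp M (F u) Y x"
    and h: "\<forall>u\<in>V. h u \<in> borel_measurable (F u) \<and> integrable M (h u)"
    and g_int: "integrable M (\<lambda>x. (Y x - (a + c * (\<Sum>u\<in>V. h u x)))\<^sup>2)"
  shows "prob_space.variance M (\<lambda>x. X x - Y x) \<le> (\<integral>x. (Y x - (a + c * (\<Sum>u\<in>V. h u x)))\<^sup>2 \<partial>M)"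
proof -
  interpret prob_space M by fact
  note orth = cond_exp_residual_orthogonal_affine_sum[OF M V F Y X h]
  have "(\<integral>x. X x - Y x \<partial>M) = 0"
    using orth(1,2) Bochner_Integration.integral_minus[of M "\<lambda>x. Y x - X x"] by (simp only: minus_diff_eq)
  then have "variance (\<lambda>x. X x - Y x) = (\<integral>x. (Y x - X x)\<^sup>2 \<partial>M)"
    by (simp only: diff_zero power2_commute)
  also have "\<dots> \<le> (\<integral>x. (Y x - (a + c * (\<Sum>u\<in>V. h u x)))\<^sup>2 \<partial>M)"
    using orth(3-5) g_int by (intro integral_sq_le_of_orthogonal)
  finally show ?thesis .
qed

section \<open>Uncorrelated signals\<close>

lemma affine_predictor_mse_eq:
  fixes n m0 m1 v0 v1 :: real
  assumes n: "0 < n" and m: "m0 \<noteq> m1" and v: "0 \<le> v0" "0 \<le> v1"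
  defines "D \<equiv> 2 * (v1 + v0) / (m1 - m0)\<^sup>2"
  defines "c \<equiv> 1 / ((n + D) * (m1 - m0))"
  defines "a \<equiv> 1/2 - c * n * (m0 + m1) / 2"
  shows "1/2 * ((1 - a - c * n * m1)\<^sup>2 + c\<^sup>2 * n * v1) + 1/2 * ((- a - c * n * m0)\<^sup>2 + c\<^sup>2 * n * v0)
    = D / (4 * (n + D))"
proof -
  define d where "d = m1 - m0"
  have d: "d \<noteq> 0" using m by (simp add: d_def)
  have "0 \<le> D" using v by (simp add: D_def)
  then have nD: "0 < n + D" using n by simp
  have cd: "c * d = 1 / (n + D)"
    using d nD by (simp add: c_def d_def)
  have e1: "1 - a - c * n * m1 = 1/2 - n * (c * d) / 2"
    and e0: "- a - c * n * m0 = - (1/2 - n * (c * d) / 2)"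
    by (simp_all add: a_def d_def field_simps)
  have ev: "c\<^sup>2 * n * (v1 + v0) = (c * d)\<^sup>2 * n * D / 2"
    using d unfolding D_def d_def[symmetric] by (simp add: power2_eq_square field_simps)
  have "1/2 * ((1 - a - c * n * m1)\<^sup>2 + c\<^sup>2 * n * v1) + 1/2 * ((- a - c * n * m0)\<^sup>2 + c\<^sup>2 * n * v0)
      = (1/2 - n * (c * d) / 2)\<^sup>2 + (c * d)\<^sup>2 * n * D / 4"
    using ev unfolding e1 e0 power2_minus by (simp add: algebra_simps)
  also have "\<dots> = (D / (2 * (n + D)))\<^sup>2 + n * D / (4 * (n + D)\<^sup>2)"
    using nD by (simp add: cd field_simps power2_eq_square)
  also have "\<dots> = (D * D + n * D) / (4 * (n + D)\<^sup>2)"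
    unfolding add_divide_distrib by (simp add: power2_eq_square algebra_simps)
  also have "\<dots> = D * (D + n) / (4 * (n + D)\<^sup>2)"
    by (simp add: algebra_simps)
  also have "\<dots> = D / (4 * (n + D))"
    using nD by (simp add: power2_eq_square add.commute)
  finally show ?thesis .
qed

locale uncorrelated_signals = prob_space M
  for M :: "'a measure" +
  fixes S :: "'a \<Rightarrow> real" and mu0 mu1 :: "'b measure" and V :: "'v set" and W :: "'v \<Rightarrow> 'a \<Rightarrow> 'b"
  assumes S_meas[measurable]: "S \<in> borel_measurable M"
    and S_vals: "\<forall>x\<in>space M. S x \<in> {0, 1}"
    and S_unif: "measure M {x\<in>space M. S x = 1} = 1 / 2"
    and mu0: "prob_space mu0" and mu1: "prob_space mu1"
    and sets_eq: "sets mu1 = sets mu0"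
    and neq: "mu0 \<noteq> mu1"
    and ac01: "absolutely_continuous mu0 mu1"
    and ac10: "absolutely_continuous mu1 mu0"
    and sq0: "integrable mu0 (\<lambda>w. (llr mu0 mu1 w)\<^sup>2)"
    and sq1: "integrable mu1 (\<lambda>w. (llr mu0 mu1 w)\<^sup>2)"
    and V_fin: "finite V" and V_ne: "V \<noteq> {}"
    and W_meas: "\<forall>u\<in>V. W u \<in> measurable M mu0"
    and W_law: "\<forall>u\<in>V. \<forall>A\<in>sets mu0.
        measure M {x\<in>space M. S x = 0 \<and> W u x \<in> A} = measure M {x\<in>space M. S x = 0} * measure mu0 A
      \<and> measure M {x\<in>space M. S x = 1 \<and> W u x \<in> A} = measure M {x\<in>space M. S x = 1} * measure mu1 A"
    and uncorr: "\<forall>u\<in>V. \<forall>v\<in>V. u \<noteq> v \<longrightarrow> (\<forall>s\<in>{0::real, 1}.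
        cond_cov M {x\<in>space M. S x = s}
          (\<lambda>x. llr mu0 mu1 (W u x)) (\<lambda>x. llr mu0 mu1 (W v x)) = 0)"
begin

definition state :: "real \<Rightarrow> 'a set" where
  "state s = {x\<in>space M. S x = s}"

lemma sets_state[measurable]: "state s \<in> sets M"
  unfolding state_def by measurable

lemma measure_state: "s \<in> {0, 1} \<Longrightarrow> measure M (state s) = 1/2"
proof -
  have "state 0 = space M - state 1"
    using S_vals by (auto simp: state_def)
  then show "s \<in> {0, 1} \<Longrightarrow> measure M (state s) = 1/2"
    using S_unif prob_compl[OF sets_state[of 1]] by (auto simp: state_def)
qed

text \<open>The pair \<open>(s, mu)\<close> is a state together with the conditional law of the signals in it.\<close>
lemma llr_state_moments:
  assumes s: "(s, mu) \<in> {(0, mu0), (1, mu1)}" and u: "u \<in> V" and v: "v \<in> V"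
  shows "integrable M (\<lambda>x. llr mu0 mu1 (W u x) * indicator (state s) x)"
    "(\<integral>x. llr mu0 mu1 (W u x) * indicator (state s) x \<partial>M) = (\<integral>w. llr mu0 mu1 w \<partial>mu) / 2"
    "integrable M (\<lambda>x. llr mu0 mu1 (W u x) * llr mu0 mu1 (W v x) * indicator (state s) x)"
    "(\<integral>x. llr mu0 mu1 (W u x) * llr mu0 mu1 (W v x) * indicator (state s) x \<partial>M) =
      (if u = v then \<integral>w. (llr mu0 mu1 w)\<^sup>2 \<partial>mu else (\<integral>w. llr mu0 mu1 w \<partial>mu)\<^sup>2) / 2"
proof -
  have mu: "prob_space mu" "sets mu = sets mu0" "integrable mu (\<lambda>w. (llr mu0 mu1 w)\<^sup>2)"
    using s mu0 mu1 sets_eq sq0 sq1 by auto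
  interpret mu: prob_space mu by (fact mu(1))
  have llr_mu[measurable]: "llr mu0 mu1 \<in> borel_measurable mu"
    using mu(2) by (rule llr_measurable_cong)
  have W: "\<forall>u\<in>V. W u \<in> measurable M mu"
    using W_meas unfolding measurable_cong_sets[OF refl mu(2)] .
  have law: "\<forall>u\<in>V. \<forall>B\<in>sets mu.
      measure M {x\<in>space M. x \<in> state s \<and> W u x \<in> B} = measure M (state s) * measure mu B"
    using s W_law mu(2) by (auto simp: state_def)
  have uncorr_s: "\<forall>u\<in>V. \<forall>v\<in>V. u \<noteq> v \<longrightarrow>
      cond_cov M (state s) (\<lambda>x. llr mu0 mu1 (W u x)) (\<lambda>x. llr mu0 mu1 (W v x)) = 0"
    using s uncorr by (auto simp: state_def)
  have half: "measure M (state s) = 1/2"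
    using s by (intro measure_state) auto
  have int: "integrable mu (llr mu0 mu1)"
    using llr_mu mu(3) by (rule mu.square_integrable_imp_integrable)
  show "integrable M (\<lambda>x. llr mu0 mu1 (W u x) * indicator (state s) x)"
    "(\<integral>x. llr mu0 mu1 (W u x) * indicator (state s) x \<partial>M) = (\<integral>w. llr mu0 mu1 w \<partial>mu) / 2"
    using integral_comp_indicator[OF finite_measure_axioms mu.finite_measure_axioms _ sets_state _ int,
        of "W u" s] W law u half by simp_all
  show "integrable M (\<lambda>x. llr mu0 mu1 (W u x) * llr mu0 mu1 (W v x) * indicator (state s) x)"
    "(\<integral>x. llr mu0 mu1 (W u x) * llr mu0 mu1 (W v x) * indicator (state s) x \<partial>M) =
      (if u = v then \<integral>w. (llr mu0 mu1 w)\<^sup>2 \<partial>mu else (\<integral>w. llr mu0 mu1 w \<partial>mu)\<^sup>2) / 2"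
    using integral_mult_comp_indicator[OF prob_space_axioms mu(1) sets_state _ W law llr_mu mu(3) uncorr_s u v]
      half by simp_all
qed

lemma integrable_llr_signal: "u \<in> V \<Longrightarrow> integrable M (\<lambda>x. llr mu0 mu1 (W u x))"
proof -
  assume u: "u \<in> V"
  have "integrable M (\<lambda>x. llr mu0 mu1 (W u x) * indicator (state 0) x
      + llr mu0 mu1 (W u x) * indicator (state 1) x)"
    using llr_state_moments(1)[of 0 mu0 u u] llr_state_moments(1)[of 1 mu1 u u] u by auto
  moreover have "llr mu0 mu1 (W u x) * indicator (state 0) x + llr mu0 mu1 (W u x) * indicator (state 1) x
      = llr mu0 mu1 (W u x)" if "x \<in> space M" for x
    using S_vals that by (auto simp: state_def split: split_indicator)
  ultimately show ?thesis
    by (simp cong: Bochner_Integration.integrable_cong)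
qed

lemma measurable_llr_signal:
  assumes "u \<in> V" "subalgebra M F" "sets (vimage_algebra (space M) (W u) mu0) \<subseteq> sets F"
  shows "(\<lambda>x. llr mu0 mu1 (W u x)) \<in> borel_measurable F"
proof -
  have "W u \<in> measurable F mu0"
    using assms W_meas by (blast intro: measurable_vimage_algebra_subset)
  then show ?thesis
    by measurable
qed

lemma integral_sq_affine_llr_state:
  assumes s: "(s, mu) \<in> {(0, mu0), (1, mu1)}"
  shows "integrable M (\<lambda>x. (t - c * (\<Sum>u\<in>V. llr mu0 mu1 (W u x)))\<^sup>2 * indicator (state s) x)"
    "(\<integral>x. (t - c * (\<Sum>u\<in>V. llr mu0 mu1 (W u x)))\<^sup>2 * indicator (state s) x \<partial>M) =
      1/2 * ((t - c * card V * (\<integral>w. llr mu0 mu1 w \<partial>mu))\<^sup>2 + c\<^sup>2 * card V * var_under mu (llr mu0 mu1))"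
proof -
  have mu: "prob_space mu" "llr mu0 mu1 \<in> borel_measurable mu" "integrable mu (\<lambda>w. (llr mu0 mu1 w)\<^sup>2)"
    using s mu0 mu1 sq0 sq1 sets_eq by (auto intro: llr_measurable_cong)
  note moments = integral_sq_affine_sum_indicator[OF finite_measure_axioms V_fin sets_state,
      of "\<lambda>u x. llr mu0 mu1 (W u x)" s "(\<integral>w. llr mu0 mu1 w \<partial>mu)" "\<integral>w. (llr mu0 mu1 w)\<^sup>2 \<partial>mu" t c]
  show "integrable M (\<lambda>x. (t - c * (\<Sum>u\<in>V. llr mu0 mu1 (W u x)))\<^sup>2 * indicator (state s) x)"
    "(\<integral>x. (t - c * (\<Sum>u\<in>V. llr mu0 mu1 (W u x)))\<^sup>2 * indicator (state s) x \<partial>M) =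
      1/2 * ((t - c * card V * (\<integral>w. llr mu0 mu1 w \<partial>mu))\<^sup>2 + c\<^sup>2 * card V * var_under mu (llr mu0 mu1))"
    using moments llr_state_moments[OF s] measure_state[of s] s var_under_eq[OF mu] by auto
qed

text \<open>The witness is the best affine predictor of the state from the sum of the
  log-likelihood ratios.\<close>
lemma exists_affine_predictor:
  "\<exists>a c. integrable M (\<lambda>x. (indicator (state 1) x - (a + c * (\<Sum>u\<in>V. llr mu0 mu1 (W u x))))\<^sup>2) \<and>
     (\<integral>x. (indicator (state 1) x - (a + c * (\<Sum>u\<in>V. llr mu0 mu1 (W u x))))\<^sup>2 \<partial>M) =
       noise_signal_ratio mu1 mu0 / (4 * (card V + noise_signal_ratio mu1 mu0))"
proof -
  interpret mu0: prob_space mu0 by (fact mu0)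
  interpret mu1: prob_space mu1 by (fact mu1)
  define m0 where "m0 = (\<integral>w. llr mu0 mu1 w \<partial>mu0)"
  define m1 where "m1 = (\<integral>w. llr mu0 mu1 w \<partial>mu1)"
  define n where "n = real (card V)"
  define D where "D = 2 * (var_under mu1 (llr mu0 mu1) + var_under mu0 (llr mu0 mu1)) / (m1 - m0)\<^sup>2"
  define c where "c = 1 / ((n + D) * (m1 - m0))"
  define a where "a = 1/2 - c * n * (m0 + m1) / 2"
  define Z where "Z x = (\<Sum>u\<in>V. llr mu0 mu1 (W u x))" for x
  have llr_int: "integrable mu0 (llr mu0 mu1)" "integrable mu1 (llr mu0 mu1)"
    using sq0 sq1 llr_measurable_cong[OF sets_eq]
    by (auto intro: mu0.square_integrable_imp_integrable mu1.square_integrable_imp_integrable)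
  have "m0 < m1"
    unfolding m0_def m1_def using mu0 mu1 sets_eq neq ac01 ac10 llr_int by (rule integral_llr_less)
  then have mse: "1/2 * ((1 - a - c * n * m1)\<^sup>2 + c\<^sup>2 * n * var_under mu1 (llr mu0 mu1))
      + 1/2 * ((- a - c * n * m0)\<^sup>2 + c\<^sup>2 * n * var_under mu0 (llr mu0 mu1)) = D / (4 * (n + D))"
    using V_fin V_ne unfolding a_def c_def D_def n_def
    by (intro affine_predictor_mse_eq) (auto simp: var_under_nonneg)
  have split_states: "(indicator (state 1) x - (a + c * Z x))\<^sup>2 =
      ((1 - a) - c * Z x)\<^sup>2 * indicator (state 1) x + ((- a) - c * Z x)\<^sup>2 * indicator (state 0) x"
    if "x \<in> space M" for x
    using S_vals that by (auto simp: state_def algebra_simps split: split_indicator)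
  have "(1, mu1) \<in> {(0, mu0), (1, mu1)}" "(0, mu0) \<in> {(0, mu0), (1, mu1)}"
    by simp_all
  note state1 = integral_sq_affine_llr_state[OF this(1), of "1 - a" c, folded Z_def]
    and state0 = integral_sq_affine_llr_state[OF this(2), of "- a" c, folded Z_def]
  have D: "D = noise_signal_ratio mu1 mu0"
    unfolding D_def m0_def m1_def
    using noise_signal_ratio_eq[OF mu0.sigma_finite_measure_axioms mu1.sigma_finite_measure_axioms
        sets_eq ac01 ac10] ..
  have int: "integrable M (\<lambda>x. (indicator (state 1) x - (a + c * Z x))\<^sup>2)"
    using state0(1) state1(1) by (simp add: Bochner_Integration.integrable_cong[OF refl split_states])
  have "(\<integral>x. (indicator (state 1) x - (a + c * Z x))\<^sup>2 \<partial>M) =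
      (\<integral>x. ((1 - a) - c * Z x)\<^sup>2 * indicator (state 1) x \<partial>M) +
      (\<integral>x. ((- a) - c * Z x)\<^sup>2 * indicator (state 0) x \<partial>M)"
    using state0(1) state1(1) by (simp add: Bochner_Integration.integral_cong[OF refl split_states])
  also have "\<dots> = D / (4 * (n + D))"
    unfolding state0(2) state1(2) using mse unfolding n_def m0_def m1_def .
  finally show ?thesis
    using int unfolding Z_def D n_def by blast
qed

end

lemma divide_quarter_le:
  fixes D n :: real
  assumes "0 \<le> D" "0 \<le> n"
  shows "D / (4 * (n + D)) \<le> D / (n + D)"
proof -
  have "0 \<le> D / (n + D)"
    using assms by simp
  moreover have "r / 4 \<le> r" if "0 \<le> r" for r :: real
    using that by simp
  ultimately have "D / (n + D) / 4 \<le> D / (n + D)"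
    by blast
  then show ?thesis
    by (metis divide_divide_eq_left mult.commute)
qed

lemma noise_signal_ratio_nonneg: "0 \<le> noise_signal_ratio mu1 mu0"
  by (simp add: noise_signal_ratio_def var_under_nonneg)

theorem mainTheorem3:
  fixes M :: "'a measure" and S :: "'a \<Rightarrow> real"
    and mu0 mu1 :: "'b measure"
    and V :: "'v set" and W :: "'v \<Rightarrow> 'a \<Rightarrow> 'b"
    and F :: "'v \<Rightarrow> 'a measure" and X :: "'a \<Rightarrow> real"
  assumes M: "prob_space M"
    and S_meas: "S \<in> borel_measurable M"
    and S_vals: "\<forall>x\<in>space M. S x \<in> {0, 1}"
    and S_unif: "measure M {x\<in>space M. S x = 1} = 1 / 2"
    and mu0: "prob_space mu0" and mu1: "prob_space mu1"
    and sets_eq: "sets mu1 = sets mu0"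
    and neq: "mu0 \<noteq> mu1"
    and ac01: "absolutely_continuous mu0 mu1"
    and ac10: "absolutely_continuous mu1 mu0"
    and sq0: "integrable mu0 (\<lambda>w. (llr mu0 mu1 w)\<^sup>2)"
    and sq1: "integrable mu1 (\<lambda>w. (llr mu0 mu1 w)\<^sup>2)"
    and V_fin: "finite V" and V_ne: "V \<noteq> {}"
    and W_meas: "\<forall>u\<in>V. W u \<in> measurable M mu0"
    and W_law: "\<forall>u\<in>V. \<forall>A\<in>sets mu0.
        measure M {x\<in>space M. S x = 0 \<and> W u x \<in> A} = measure M {x\<in>space M. S x = 0} * measure mu0 A
      \<and> measure M {x\<in>space M. S x = 1 \<and> W u x \<in> A} = measure M {x\<in>space M. S x = 1} * measure mu1 A"
    and uncorr: "\<forall>u\<in>V. \<forall>v\<in>V. u \<noteq> v \<longrightarrow> (\<forall>s\<in>{0::real, 1}.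
        cond_cov M {x\<in>space M. S x = s}
          (\<lambda>x. llr mu0 mu1 (W u x)) (\<lambda>x. llr mu0 mu1 (W v x)) = 0)"
    and F_sub: "\<forall>u\<in>V. subalgebra M (F u)"
    and F_lower: "\<forall>u\<in>V. sets (vimage_algebra (space M) (W u) mu0) \<subseteq> sets (F u)"
    and F_upper: "\<forall>u\<in>V. sets (F u) \<subseteq>
        sigma_sets (space M) (\<Union>v\<in>V. {W v -` A \<inter> space M | A. A \<in> sets mu0})"
    and common_knowledge: "\<forall>u\<in>V. \<forall>w\<in>V. \<exists>g\<in>borel_measurable (F w).
        AE x in M. real_cond_exp M (F u) (indicator {y\<in>space M. S y = 1}) x = g x"
    and X_meas: "X \<in> borel_measurable M"
    and X_agree: "AE x in M. \<forall>u\<in>V. X x = real_cond_exp M (F u) (indicator {y\<in>space M. S y = 1}) x"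
  shows "prob_space.variance M (\<lambda>x. X x - S x)
           \<le> noise_signal_ratio mu1 mu0 / (real (card V) + noise_signal_ratio mu1 mu0)"
proof -
  interpret uncorrelated_signals M S mu0 mu1 V W
    by (intro uncorrelated_signals.intro uncorrelated_signals_axioms.intro) (rule assms)+
  define Y where "Y = (indicator (state 1) :: 'a \<Rightarrow> real)"
  define D where "D = noise_signal_ratio mu1 mu0"
  obtain a c where pred_int: "integrable M (\<lambda>x. (Y x - (a + c * (\<Sum>u\<in>V. llr mu0 mu1 (W u x))))\<^sup>2)"
    and pred_mse: "(\<integral>x. (Y x - (a + c * (\<Sum>u\<in>V. llr mu0 mu1 (W u x))))\<^sup>2 \<partial>M) = D / (4 * (card V + D))"
    using exists_affine_predictor unfolding Y_def D_def by blast
  have signals: "\<forall>u\<in>V. (\<lambda>x. llr mu0 mu1 (W u x)) \<in> borel_measurable (F u) \<and>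
      integrable M (\<lambda>x. llr mu0 mu1 (W u x))"
    using F_sub F_lower by (auto intro: measurable_llr_signal integrable_llr_signal)
  have "X x - S x = X x - Y x" if "x \<in> space M" for x
    using S_vals that by (auto simp: Y_def state_def)
  then have "prob_space.variance M (\<lambda>x. X x - S x) = prob_space.variance M (\<lambda>x. X x - Y x)"
    by (simp cong: Bochner_Integration.integral_cong)
  also have "\<dots> \<le> D / (4 * (card V + D))"
    using cond_exp_mse_le_affine_sum[OF M V_fin V_ne F_sub _ _ X_meas _ signals pred_int] X_agree pred_mse
    by (auto simp: Y_def state_def)
  also have "\<dots> \<le> D / (card V + D)"
    using noise_signal_ratio_nonneg[of mu1 mu0] by (intro divide_quarter_le) (simp_all add: D_def)
  finally show ?thesis
    unfolding D_def .
qed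

end
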